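(* Let $R=\mathbb F_{q_1}\times\cdots\times\mathbb F_{q_t}$ be a product of $t\ge 3$ finite fields of arbitrary orders $q_1,\dots,q_t$, and let $k^\ast=\operatorname{argmin}_i q_i$ (any index at which $q_i$ is minimal). Then the minimum degree of $\mathcal D(R)$ is attained exactly at the singleton class of smallest field order, i.e. exactly at the vertices of the classes $X_{\{k\}}$ with $q_k=\min_i q_i$, and $$\delta(\mathcal D(R))=|Z(R)^*|-\prod_{i\ne k^\ast}q_i=(q_{k^\ast}-1)\Biggl(\prod_{i\ne k^\ast}q_i-\prod_{i\ne k^\ast}(q_i-1)\Biggr)-1.$$
   Context: $[t]=\{1,\dots,t\}$; products over $i\ne k^\ast$ run over $i\in[t]\setminus\{k^\ast\}$. $Z(R)$ is the set of zero-divisors of $R$ and $Z(R)^*=Z(R)\setminus\{0\}$. For $x=(x_1,\dots,x_t)\in R$, $\operatorname{supp}(x)=\{i\in[t]:x_i\ne0\}$, and $X_A=\{x\in Z(R)^*:\operatorname{supp}(x)=A\}$ for nonempty proper $A\subsetneq[t]$. $\Gamma(R)$ is the simple graph with vertex set $Z(R)^*$, with distinct $x,y$ adjacent iff $xy=0$. $W\Gamma(R)$ is the simple graph with vertex set $Z(R)^*$, with distinct $x,y$ adjacent iff there exist nonzero $r\in\operatorname{Ann}(x)$ and nonzero $s\in\operatorname{Ann}(y)$ with $rs=0$. The weak zero-divisor difference graph $\mathcal D(R)$ is the graph on $Z(R)^*$ with edge set $E(W\Gamma(R))\setminus E(\Gamma(R))$, with resulting isolated vertices deleted (for $t\ge3$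 no vertex is in fact isolated, so the vertex set is $Z(R)^*$). $\delta(G)$ is the minimum degree of $G$. *)

theory Defs
  imports "HOL-Algebra.Chinese_Remainder"
begin

section \<open>Finite simple graphs\<close>

text \<open>Edges are two-element sets of vertices.\<close>

record 'v sgraph =
  sverts :: "'v set"
  sedges :: "'v set set"

text \<open>The simple graph on \<open>V\<close> in which distinct \<open>x\<close>, \<open>y\<close> are adjacent iff \<open>adj x y\<close>;
  \<open>adj\<close> is meant to be symmetric on \<open>V\<close>.\<close>

definition graph_of_rel :: "'v set \<Rightarrow> ('v \<Rightarrow> 'v \<Rightarrow> bool) \<Rightarrow> 'v sgraph" where
  "graph_of_rel V adj =
     \<lparr> sverts = V, sedges = {{x, y} | x y. x \<in> V \<and> y \<in> V \<and> x \<noteq> y \<and> adj x y} \<rparr>"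

definition delete_isolated :: "'v sgraph \<Rightarrow> 'v sgraph" where
  "delete_isolated G =
     \<lparr> sverts = {v \<in> sverts G. \<exists>e \<in> sedges G. v \<in> e}, sedges = sedges G \<rparr>"

definition sdegree :: "'v sgraph \<Rightarrow> 'v \<Rightarrow> nat" where
  "sdegree G v = card {e \<in> sedges G. v \<in> e}"

definition min_degree :: "'v sgraph \<Rightarrow> nat" where
  "min_degree G = Min (sdegree G ` sverts G)"


section \<open>Zero-divisors and the associated graphs\<close>

text \<open>\<open>R\<close> is always a commutative ring below, so one-sided notions suffice.
  In a nonzero ring, zero counts as a zero-divisor; it is removed in \<open>nz_zero_divisors\<close>.\<close>

definition zero_divisors :: "('a, 'm) ring_scheme \<Rightarrow> 'a set" where
  "zero_divisors R =
     {x \<in> carrier R. \<exists>y \<in> carrier R. y \<noteq> \<zero>\<^bsub>R\<^esub> \<and> x \<otimes>\<^bsub>R\<^esub> y = \<zero>\<^bsub>R\<^esub>}"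

definition nz_zero_divisors :: "('a, 'm) ring_scheme \<Rightarrow> 'a set" where
  "nz_zero_divisors R = zero_divisors R - {\<zero>\<^bsub>R\<^esub>}"

definition Ann :: "('a, 'm) ring_scheme \<Rightarrow> 'a \<Rightarrow> 'a set" where
  "Ann R x = {r \<in> carrier R. r \<otimes>\<^bsub>R\<^esub> x = \<zero>\<^bsub>R\<^esub>}"

definition zero_divisor_graph :: "('a, 'm) ring_scheme \<Rightarrow> 'a sgraph" where
  "zero_divisor_graph R =
     graph_of_rel (nz_zero_divisors R) (\<lambda>x y. x \<otimes>\<^bsub>R\<^esub> y = \<zero>\<^bsub>R\<^esub>)"

definition weak_zero_divisor_graph :: "('a, 'm) ring_scheme \<Rightarrow> 'a sgraph" where
  "weak_zero_divisor_graph R =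
     graph_of_rel (nz_zero_divisors R)
       (\<lambda>x y. \<exists>r \<in> Ann R x - {\<zero>\<^bsub>R\<^esub>}. \<exists>s \<in> Ann R y - {\<zero>\<^bsub>R\<^esub>}. r \<otimes>\<^bsub>R\<^esub> s = \<zero>\<^bsub>R\<^esub>)"

definition weak_difference_graph :: "('a, 'm) ring_scheme \<Rightarrow> 'a sgraph" where
  "weak_difference_graph R =
     delete_isolated
       \<lparr> sverts = nz_zero_divisors R,
         sedges = sedges (weak_zero_divisor_graph R) - sedges (zero_divisor_graph R) \<rparr>"


section \<open>Support classes in a finite product of rings\<close>

text \<open>Elements of \<open>RDirProd_list Fs\<close> are lists, so coordinates are numbered
  \<open>0, \<dots>, t - 1\<close> with \<open>t = length Fs\<close>, instead of \<open>1, \<dots>, t\<close>.\<close>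

definition supp :: "('a, 'm) ring_scheme list \<Rightarrow> 'a list \<Rightarrow> nat set" where
  "supp Fs x = {i. i < length Fs \<and> x ! i \<noteq> \<zero>\<^bsub>Fs ! i\<^esub>}"

definition support_class :: "('a, 'm) ring_scheme list \<Rightarrow> nat set \<Rightarrow> 'a list set" where
  "support_class Fs A = {x \<in> nz_zero_divisors (RDirProd_list Fs). supp Fs x = A}"

end

theory Submission
  imports Defs
begin

text \<open>
  Two vertices with supports \<open>A\<close> and \<open>B\<close> are adjacent in the difference graph iff \<open>A\<close> meets \<open>B\<close> and
  it is not the case that both are the complement of one and the same index. So the number of vertices that are not
  neighbours of a vertex depends only on its support \<open>A\<close>: it is \<open>\<Prod>i\<notin>A. q i\<close> unless
  \<open>A\<close> misses just one index \<open>j\<close>, when it is \<open>(q j - 1) + (\<Prod>i\<noteq>j. q i - 1)\<close>. The first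
  expression is maximal exactly for \<open>A = {k}\<close> with \<open>q k\<close> minimal, and the second is always strictly
  smaller than that maximum.
\<close>

section \<open>Degrees in simple graphs\<close>

text \<open>Edges are unordered, so \<open>Q\<close> has to be symmetric: otherwise an edge
  \<open>{x, y}\<close> with \<open>P x y\<close> and not \<open>Q x y\<close> could still be
  removed because of \<open>Q y x\<close>.\<close>

lemma sedges_graph_of_rel_diff:
  assumes "\<And>x y. x \<in> V \<Longrightarrow> y \<in> V \<Longrightarrow> Q x y \<Longrightarrow> Q y x"
  shows "sedges (graph_of_rel V P) - sedges (graph_of_rel V Q) =
           sedges (graph_of_rel V (\<lambda>x y. P x y \<and> \<not> Q x y))"
proof (intro equalityI subsetI)
  fix e assume e: "e \<in> sedges (graph_of_rel V P) - sedges (graph_of_rel V Q)"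
  then obtain x y where xy: "e = {x, y}" "x \<in> V" "y \<in> V" "x \<noteq> y" "P x y"
    unfolding graph_of_rel_def by auto
  then have "\<not> Q x y" using e unfolding graph_of_rel_def by auto
  then show "e \<in> sedges (graph_of_rel V (\<lambda>x y. P x y \<and> \<not> Q x y))"
    using xy unfolding graph_of_rel_def by auto
next
  fix e assume "e \<in> sedges (graph_of_rel V (\<lambda>x y. P x y \<and> \<not> Q x y))"
  then obtain x y where xy: "e = {x, y}" "x \<in> V" "y \<in> V" "x \<noteq> y" "P x y" "\<not> Q x y"
    unfolding graph_of_rel_def by auto
  have "e \<notin> sedges (graph_of_rel V Q)"
  proof
    assume "e \<in> sedges (graph_of_rel V Q)"
    then obtain u v where "e = {u, v}" "u \<in> V" "v \<in> V" "Q u v"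
      unfolding graph_of_rel_def by auto
    then show False
      using xy assms[of u v] by (auto simp: doubleton_eq_iff)
  qed
  then show "e \<in> sedges (graph_of_rel V P) - sedges (graph_of_rel V Q)"
    using xy unfolding graph_of_rel_def by auto
qed

lemma graph_of_rel_cong:
  assumes "\<And>x y. x \<in> V \<Longrightarrow> y \<in> V \<Longrightarrow> P x y \<longleftrightarrow> Q x y"
  shows "graph_of_rel V P = graph_of_rel V Q"
proof -
  have "(\<exists>x y. e = {x, y} \<and> x \<in> V \<and> y \<in> V \<and> x \<noteq> y \<and> P x y) \<longleftrightarrow>
        (\<exists>x y. e = {x, y} \<and> x \<in> V \<and> y \<in> V \<and> x \<noteq> y \<and> Q x y)" for e
    by (intro iff_exI) (use assms in auto)
  then show ?thesis
    by (simp add: graph_of_rel_def)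
qed

text \<open>Edges through \<open>x\<close> correspond to neighbours by sending \<open>y\<close> to
  \<open>{x, y}\<close>; the symmetry assumption handles an edge that was formed with
  \<open>x\<close> in second place.\<close>

lemma sdegree_graph_of_rel:
  assumes x: "x \<in> V" and sym: "\<And>y. y \<in> V \<Longrightarrow> adj y x \<Longrightarrow> adj x y"
  shows "sdegree (graph_of_rel V adj) x = card {y \<in> V. y \<noteq> x \<and> adj x y}"
proof -
  have "{e \<in> sedges (graph_of_rel V adj). x \<in> e} = (\<lambda>y. {x, y}) ` {y \<in> V. y \<noteq> x \<and> adj x y}"
  proof (intro equalityI subsetI)
    fix e assume "e \<in> {e \<in> sedges (graph_of_rel V adj). x \<in> e}"
    then obtain u v where "e = {u, v}" "u \<in> V" "v \<in> V" "u \<noteq> v" "adj u v" "x = u \<or> x = v"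
      unfolding graph_of_rel_def by auto
    then show "e \<in> (\<lambda>y. {x, y}) ` {y \<in> V. y \<noteq> x \<and> adj x y}"
      using sym by blast
  next
    fix e assume "e \<in> (\<lambda>y. {x, y}) ` {y \<in> V. y \<noteq> x \<and> adj x y}"
    then show "e \<in> {e \<in> sedges (graph_of_rel V adj). x \<in> e}"
      using x unfolding graph_of_rel_def by auto
  qed
  moreover have "inj_on (\<lambda>y. {x, y}) {y \<in> V. y \<noteq> x \<and> adj x y}"
    by (auto simp: inj_on_def doubleton_eq_iff)
  ultimately show ?thesis
    by (simp add: sdegree_def card_image)
qed

lemma sdegree_delete_isolated [simp]: "sdegree (delete_isolated G) v = sdegree G v"
  by (simp add: sdegree_def delete_isolated_def)

text \<open>Finiteness makes positive degree equivalent to lying on an edge, since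
  \<open>card\<close> is 0 on infinite sets.\<close>

lemma sverts_delete_isolated:
  assumes "finite (sedges G)"
  shows "sverts (delete_isolated G) = {v \<in> sverts G. 0 < sdegree G v}"
proof -
  have "0 < sdegree G v \<longleftrightarrow> (\<exists>e \<in> sedges G. v \<in> e)" for v
    using assms by (simp add: sdegree_def card_gt_0_iff) blast
  then show ?thesis
    by (auto simp: delete_isolated_def)
qed

lemma finite_sedges_graph_of_rel:
  assumes "finite V"
  shows "finite (sedges (graph_of_rel V adj))"
  by (rule finite_subset[of _ "Pow V"]) (use assms in \<open>auto simp: graph_of_rel_def\<close>)

lemma sverts_graph_of_rel [simp]: "sverts (graph_of_rel V adj) = V"
  by (simp add: graph_of_rel_def)

lemma min_degree_eqI:
  assumes fin: "finite (sverts G)" and v: "v \<in> sverts G"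
    and le: "\<And>w. w \<in> sverts G \<Longrightarrow> sdegree G v \<le> sdegree G w"
  shows "min_degree G = sdegree G v"
  unfolding min_degree_def using assms by (intro Min_eqI) auto


section \<open>Products of the field orders\<close>

lemma prod_less_prod_superset:
  fixes q :: "'b \<Rightarrow> nat"
  assumes "finite I" "J \<subset> I" and q: "\<And>i. i \<in> I \<Longrightarrow> 2 \<le> q i"
  shows "prod q J < prod q I"
proof -
  obtain j where j: "j \<in> I - J" using assms by auto
  have "prod q J * 1 < prod q J * prod q (I - J)"
  proof (rule mult_strict_left_mono)
    have "1 < q j" using j q[of j] by auto
    also have "q j \<le> prod q (I - J)"
      using j assms by (intro dvd_imp_le dvd_prodI prod_pos) force+
    finally show "1 < prod q (I - J)" .
    show "0 < prod q J" using assms by (intro prod_pos) force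
  qed
  also have "\<dots> = prod q I"
    using assms by (metis mult.commute prod.subset_diff psubset_imp_subset)
  finally show ?thesis by simp
qed

text \<open>Multiplying each product by its missing factor gives \<open>prod q I\<close>, so the
  smaller missing factor leaves the larger product.\<close>

lemma prod_remove_le_prod_remove:
  fixes q :: "'b \<Rightarrow> nat"
  assumes "finite I" "j \<in> I" "k \<in> I" and q: "\<And>i. i \<in> I \<Longrightarrow> 0 < q i" and le: "q k \<le> q j"
  shows "prod q (I - {j}) \<le> prod q (I - {k})"
    and "prod q (I - {j}) = prod q (I - {k}) \<longleftrightarrow> q j = q k"
proof -
  have eq: "q j * prod q (I - {j}) = q k * prod q (I - {k})"
    using assms by (metis prod.remove)
  have pos: "0 < prod q (I - {j})" "0 < prod q (I - {k})" "0 < q k"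
    using assms by (auto intro!: prod_pos)
  have "q k * prod q (I - {j}) \<le> q k * prod q (I - {k})"
    using le mult_right_mono[OF le, of "prod q (I - {j})"] eq by simp
  then show "prod q (I - {j}) \<le> prod q (I - {k})"
    using pos by simp
  show "prod q (I - {j}) = prod q (I - {k}) \<longleftrightarrow> q j = q k"
    using eq pos by auto
qed

text \<open>For \<open>a\<close> in \<open>A\<close>, the complement of \<open>A\<close> lies in
  that of \<open>{a}\<close>, properly unless \<open>A = {a}\<close>, and a proper subset has a
  strictly smaller product. It remains to compare omitting \<open>a\<close> with omitting
  \<open>k\<close>.\<close>

lemma prod_compl_le_prod_remove:
  fixes q :: "'b \<Rightarrow> nat"
  assumes fin: "finite I" and A: "A \<subseteq> I" "A \<noteq> {}" and k: "k \<in> I"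
    and q: "\<And>i. i \<in> I \<Longrightarrow> 2 \<le> q i" and min: "\<And>i. i \<in> I \<Longrightarrow> q k \<le> q i"
  shows "prod q (I - A) \<le> prod q (I - {k})"
    and "prod q (I - A) = prod q (I - {k}) \<longleftrightarrow> (\<exists>j \<in> I. A = {j} \<and> q j = q k)"
proof -
  have q0: "0 < q i" if "i \<in> I" for i using q[OF that] by simp
  obtain a where a: "a \<in> A" using A by auto
  then have aI: "a \<in> I" using A by auto
  note rem = prod_remove_le_prod_remove[OF fin aI k q0 min[OF aI]]
  consider "A = {a}" | "prod q (I - A) < prod q (I - {a})"
    using a A q fin by (cases "A = {a}") (auto intro!: prod_less_prod_superset)
  then have "prod q (I - A) \<le> prod q (I - {k}) \<and>
      (prod q (I - A) = prod q (I - {k}) \<longleftrightarrow> (\<exists>j \<in> I. A = {j} \<and> q j = q k))"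
  proof cases
    case 1
    then show ?thesis using rem aI by simp
  next
    case 2
    then have "A \<noteq> {j}" for j using a by auto
    then show ?thesis using 2 rem by auto
  qed
  then show "prod q (I - A) \<le> prod q (I - {k})"
    and "prod q (I - A) = prod q (I - {k}) \<longleftrightarrow> (\<exists>j \<in> I. A = {j} \<and> q j = q k)"
    by auto
qed

lemma prod_pred_less_prod:
  fixes q :: "'b \<Rightarrow> nat"
  assumes "finite J" "J \<noteq> {}" and q: "\<And>i. i \<in> J \<Longrightarrow> 2 \<le> q i"
  shows "(\<Prod>i\<in>J. q i - 1) < prod q J"
proof -
  obtain i where i: "i \<in> J" using assms by auto
  have "q i - 1 < q i" if "i \<in> J" for i using q[OF that] by simp
  moreover have "0 < q i" if "i \<in> J" for i using q[OF that] by simp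
  ultimately show ?thesis
    using assms i by (intro prod_mono_strict[of i]) (auto simp: less_imp_le)
qed

text \<open>The left-hand side counts the non-neighbours of a vertex whose support misses only \<open>j\<close>.\<close>

lemma coatom_count_less:
  fixes q :: "'b \<Rightarrow> nat"
  assumes fin: "finite I" and I: "3 \<le> card I" and j: "j \<in> I" and k: "k \<in> I"
    and q: "\<And>i. i \<in> I \<Longrightarrow> 2 \<le> q i" and min: "\<And>i. i \<in> I \<Longrightarrow> q k \<le> q i"
  shows "(q j - 1) + (\<Prod>i\<in>I - {j}. q i - 1) < prod q (I - {k})"
proof -
  \<comment> \<open>If \<open>j = k\<close>, any other index serves as \<open>l\<close>; otherwise
    \<open>l\<close> is \<open>k\<close>. Either way exactly one of \<open>j\<close> and
    \<open>l\<close> survives in \<open>I - {k}\<close>, and by minimality of \<open>q k\<close> its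
    order is the maximum of the two.\<close>
  obtain l where l: "l \<in> I" "l \<noteq> j"
    and N: "prod q (I - {k}) = max (q j) (q l) * prod q (I - {j, l})"
  proof (cases "j = k")
    case True
    have "\<not> I \<subseteq> {k}" using I card_mono[of "{k}" I] by auto
    then obtain l where l: "l \<in> I" "l \<noteq> k" by blast
    have "I - {k} - {l} = I - {j, l}" using True by auto
    then have "prod q (I - {k}) = q l * prod q (I - {j, l})"
      using prod.remove[of "I - {k}" l q] l fin by simp
    then show thesis using that[of l] l True min[of l] by (simp add: max_def)
  next
    case False
    have "I - {k} - {j} = I - {j, k}" by auto
    then have "prod q (I - {k}) = q j * prod q (I - {j, k})"
      using prod.remove[of "I - {k}" j q] j False fin by simp
    then show thesis using that[of k] k False min[of j] j by (auto simp: max_def)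
  qed
  define m M M' where "m = max (q j) (q l)" and "M = prod q (I - {j, l})"
    and "M' = (\<Prod>i\<in>I - {j, l}. q i - 1)"
  \<comment> \<open>A third index exists, so the products over the remaining indices differ
    strictly.\<close>
  have "\<not> I \<subseteq> {j, l}"
    using I card_mono[of "{j, l}" I] l by (auto simp: card_insert_if)
  then have less: "M' < M"
    unfolding M_def M'_def using fin q by (intro prod_pred_less_prod) auto
  have m: "2 \<le> m" "q j \<le> m" "q l \<le> m" using q[OF j] by (auto simp: m_def)
  have "I - {j} - {l} = I - {j, l}" by auto
  then have "(q j - 1) + (\<Prod>i\<in>I - {j}. q i - 1) = (q j - 1) + (q l - 1) * M'"
    using prod.remove[of "I - {j}" l "\<lambda>i. q i - 1"] l fin by (simp add: M'_def)
  \<comment> \<open>Here \<open>M'\<close> is at most \<open>M - 1\<close>; after this bound the sum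
    collapses to \<open>(m - 1) * M\<close>.\<close>
  also have "\<dots> \<le> (m - 1) + (m - 1) * (M - 1)"
    using m less by (intro add_mono mult_le_mono) auto
  also have "\<dots> = (m - 1) * M"
    using less by (cases M) auto
  also have "\<dots> < m * M"
    using m less by (intro mult_strict_right_mono) auto
  finally show ?thesis unfolding N m_def M_def .
qed


section \<open>Products of finite fields\<close>

text \<open>A list of length \<open>n\<close> amounts to an extensional function on
  \<open>{..<n}\<close>, which reduces the count to that of a dependent product
  \<open>PiE\<close>.\<close>

lemma card_lists_prod:
  "card {x. length x = n \<and> (\<forall>i<n. x ! i \<in> S i)} = (\<Prod>i<n. card (S i))"
proof -
  have "bij_betw (\<lambda>f. map f [0..<n]) (PiE {..<n} S) {x. length x = n \<and> (\<forall>i<n. x ! i \<in> S i)}"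
  proof (rule bij_betw_byWitness[where f' = "\<lambda>x. restrict (\<lambda>i. x ! i) {..<n}"])
    show "\<forall>f\<in>PiE {..<n} S. restrict (\<lambda>i. map f [0..<n] ! i) {..<n} = f"
    proof
      fix f assume "f \<in> PiE {..<n} S"
      then show "restrict (\<lambda>i. map f [0..<n] ! i) {..<n} = f"
        by (intro extensionalityI[of _ "{..<n}"]) (simp_all add: PiE_iff)
    qed
    show "\<forall>x\<in>{x. length x = n \<and> (\<forall>i<n. x ! i \<in> S i)}. map (restrict (\<lambda>i. x ! i) {..<n}) [0..<n] = x"
      by (simp add: list_eq_iff_nth_eq)
  qed (simp_all add: image_subset_iff PiE_iff)
  from bij_betw_same_card[OF this] show ?thesis
    by (simp add: card_PiE)
qed

text \<open>Induction on the list of rings: consing a head onto a tail is a ring homomorphism from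
  the binary product, so each stage multiplies head and tail separately.\<close>

lemma RDirProd_list_mult_nth:
  assumes "\<And>i. i < length Rs \<Longrightarrow> ring (Rs ! i)"
    and "x \<in> carrier (RDirProd_list Rs)" "y \<in> carrier (RDirProd_list Rs)" "i < length Rs"
  shows "(x \<otimes>\<^bsub>RDirProd_list Rs\<^esub> y) ! i = x ! i \<otimes>\<^bsub>Rs ! i\<^esub> y ! i"
  using assms
proof (induction Rs arbitrary: x y i)
  case (Cons R Rs)
  obtain a as b bs where x: "x = a # as" "a \<in> carrier R" "as \<in> carrier (RDirProd_list Rs)"
    and y: "y = b # bs" "b \<in> carrier R" "bs \<in> carrier (RDirProd_list Rs)"
    using Cons.prems by (auto simp: RDirProd_list_carrier)
  have mult: "x \<otimes>\<^bsub>RDirProd_list (R # Rs)\<^esub> y = (a \<otimes>\<^bsub>R\<^esub> b) # (as \<otimes>\<^bsub>RDirProd_list Rs\<^esub> bs)"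
    using ring_hom_mult[OF RDirProd_list_hom1, of "(a, as)" R Rs "(b, bs)"] x y
    by (simp add: RDirProd_carrier RDirProd_def DirProd_def monoid.defs)
  show ?case
  proof (cases i)
    case (Suc j)
    have "ring (Rs ! n)" if "n < length Rs" for n
      using Cons.prems(1)[of "Suc n"] that by simp
    then show ?thesis
      using Cons.IH[of as bs j] Cons.prems x y mult Suc by simp
  qed (use x y mult in simp)
qed simp

lemma RDirProd_list_zero_nth:
  "length \<zero>\<^bsub>RDirProd_list Rs\<^esub> = length Rs"
  "i < length Rs \<Longrightarrow> \<zero>\<^bsub>RDirProd_list Rs\<^esub> ! i = \<zero>\<^bsub>Rs ! i\<^esub>"
proof -
  show "length \<zero>\<^bsub>RDirProd_list Rs\<^esub> = length Rs"
    by (induction Rs) (simp_all add: RDirProd_list_zero monoid.defs)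
  show "i < length Rs \<Longrightarrow> \<zero>\<^bsub>RDirProd_list Rs\<^esub> ! i = \<zero>\<^bsub>Rs ! i\<^esub>"
    by (induction Rs arbitrary: i) (simp_all add: RDirProd_list_zero nth_Cons split: nat.split)
qed

locale finite_field_list =
  fixes Fs :: "('a, 'm) ring_scheme list"
  assumes field_nth: "i < length Fs \<Longrightarrow> field (Fs ! i)"
    and finite_nth: "i < length Fs \<Longrightarrow> finite (carrier (Fs ! i))"
begin

abbreviation (input) "R \<equiv> RDirProd_list Fs"
abbreviation (input) "I \<equiv> {..<length Fs}"
abbreviation (input) "q i \<equiv> order (Fs ! i)"

lemma ring_nth: "i < length Fs \<Longrightarrow> ring (Fs ! i)"
  using field_nth field.is_ring by blast

lemma ring_R: "ring R"
  by (rule RDirProd_list_is_ring) (rule ring_nth)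

lemma order_ge_2:
  assumes "i < length Fs"
  shows "2 \<le> q i"
proof -
  interpret field "Fs ! i" by (rule field_nth[OF assms])
  have "card {\<zero>\<^bsub>Fs ! i\<^esub>, \<one>\<^bsub>Fs ! i\<^esub>} \<le> q i"
    unfolding order_def by (intro card_mono finite_nth assms) auto
  then show ?thesis
    by (simp add: one_not_zero[symmetric])
qed

lemma card_carrier_nonzero:
  assumes "i < length Fs"
  shows "card (carrier (Fs ! i) - {\<zero>\<^bsub>Fs ! i\<^esub>}) = q i - 1"
proof -
  interpret field "Fs ! i" by (rule field_nth[OF assms])
  show ?thesis
    unfolding order_def by (simp add: finite_nth assms)
qed

section \<open>Counting ring elements by support\<close>

lemma carrier_R: "carrier R = {x. length x = length Fs \<and> (\<forall>i<length Fs. x ! i \<in> carrier (Fs ! i))}"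
  using RDirProd_list_carrier_mem RDirProd_list_carrier_memI by blast

text \<open>Coordinates in \<open>B\<close> are free; those outside can only be zero and contribute
  a factor 1.\<close>

lemma card_supp_subset:
  assumes "B \<subseteq> I"
  shows "card {x \<in> carrier R. supp Fs x \<subseteq> B} = (\<Prod>i\<in>B. q i)"
proof -
  let ?S = "\<lambda>i. if i \<in> B then carrier (Fs ! i) else {\<zero>\<^bsub>Fs ! i\<^esub>}"
  have "{x \<in> carrier R. supp Fs x \<subseteq> B} = {x. length x = length Fs \<and> (\<forall>i<length Fs. x ! i \<in> ?S i)}"
    using ring_nth ring.ring_simprules(2) by (fastforce simp: carrier_R supp_def split: if_splits)
  then have "card {x \<in> carrier R. supp Fs x \<subseteq> B} = (\<Prod>i\<in>I. if i \<in> B then q i else 1)"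
    by (simp only: card_lists_prod) (auto simp: order_def intro!: prod.cong)
  then show ?thesis
    using assms by (simp add: prod.If_cases Int_absorb1)
qed

lemma card_supp_eq:
  assumes "B \<subseteq> I"
  shows "card {x \<in> carrier R. supp Fs x = B} = (\<Prod>i\<in>B. q i - 1)"
proof -
  let ?S = "\<lambda>i. if i \<in> B then carrier (Fs ! i) - {\<zero>\<^bsub>Fs ! i\<^esub>} else {\<zero>\<^bsub>Fs ! i\<^esub>}"
  have "{x \<in> carrier R. supp Fs x = B} = {x. length x = length Fs \<and> (\<forall>i<length Fs. x ! i \<in> ?S i)}"
  proof (intro equalityI subsetI)
    fix x assume "x \<in> {x \<in> carrier R. supp Fs x = B}"
    then show "x \<in> {x. length x = length Fs \<and> (\<forall>i<length Fs. x ! i \<in> ?S i)}"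
      by (auto simp: carrier_R supp_def)
  next
    fix x assume x: "x \<in> {x. length x = length Fs \<and> (\<forall>i<length Fs. x ! i \<in> ?S i)}"
    then have "x ! i \<in> carrier (Fs ! i)" if "i < length Fs" for i
      using that ring.ring_simprules(2)[OF ring_nth[OF that]] by (cases "i \<in> B") auto
    moreover have "x ! i \<noteq> \<zero>\<^bsub>Fs ! i\<^esub> \<longleftrightarrow> i \<in> B" if "i < length Fs" for i
      using x that by (cases "i \<in> B") auto
    then have "supp Fs x = B"
      using assms by (auto simp: supp_def)
    ultimately show "x \<in> {x \<in> carrier R. supp Fs x = B}"
      using x by (auto simp: carrier_R)
  qed
  then have "card {x \<in> carrier R. supp Fs x = B} = (\<Prod>i\<in>I. if i \<in> B then q i - 1 else 1)"
    by (simp only: card_lists_prod) (auto simp: card_carrier_nonzero intro!: prod.cong)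
  then show ?thesis
    using assms by (simp add: prod.If_cases Int_absorb1)
qed

lemma finite_carrier_R: "finite (carrier R)"
proof -
  have "carrier R = {x \<in> carrier R. supp Fs x \<subseteq> I}" by (auto simp: supp_def)
  \<comment> \<open>A positive \<open>card\<close> forces the set to be finite.\<close>
  moreover have "0 < (\<Prod>i\<in>I. q i)" using order_ge_2 by (intro prod_pos) force
  ultimately show ?thesis
    using card_supp_subset[of I] by (metis card_gt_0_iff order_refl)
qed

lemma supp_subset: "supp Fs x \<subseteq> I"
  by (auto simp: supp_def)

text \<open>Source of all witnesses with a prescribed support: their number is a product of positive
  factors \<open>q i - 1\<close>.\<close>

lemma ex_supp_eq:
  assumes "B \<subseteq> I"
  obtains x where "x \<in> carrier R" "supp Fs x = B"
proof -
  have "0 < q i - 1" if "i \<in> B" for i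
    using order_ge_2[of i] that assms by auto
  then have "0 < card {x \<in> carrier R. supp Fs x = B}"
    unfolding card_supp_eq[OF assms] by (intro prod_pos) auto
  then show thesis
    using that by (auto simp: card_gt_0_iff)
qed

section \<open>Zero-divisors and adjacency in terms of supports\<close>

lemma supp_zero [simp]: "supp Fs \<zero>\<^bsub>R\<^esub> = {}"
  by (auto simp: supp_def RDirProd_list_zero_nth)

lemma zero_iff_supp:
  assumes "x \<in> carrier R"
  shows "x = \<zero>\<^bsub>R\<^esub> \<longleftrightarrow> supp Fs x = {}"
  using assms by (auto simp: list_eq_iff_nth_eq RDirProd_list_zero_nth carrier_R supp_def)

text \<open>In each coordinate the product vanishes only if a factor does, because fields are
  integral domains.\<close>

lemma mult_zero_iff_supp:
  assumes xy: "x \<in> carrier R" "y \<in> carrier R"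
  shows "x \<otimes>\<^bsub>R\<^esub> y = \<zero>\<^bsub>R\<^esub> \<longleftrightarrow> supp Fs x \<inter> supp Fs y = {}"
proof -
  have "(x \<otimes>\<^bsub>R\<^esub> y) ! i = \<zero>\<^bsub>Fs ! i\<^esub> \<longleftrightarrow> x ! i = \<zero>\<^bsub>Fs ! i\<^esub> \<or> y ! i = \<zero>\<^bsub>Fs ! i\<^esub>"
    if i: "i < length Fs" for i
  proof -
    interpret field "Fs ! i" by (rule field_nth[OF i])
    show ?thesis
      using xy i by (simp add: RDirProd_list_mult_nth ring_nth integral_iff carrier_R)
  qed
  moreover have "x \<otimes>\<^bsub>R\<^esub> y \<in> carrier R"
    using ring_R xy by (meson monoid.m_closed ring.is_monoid)
  ultimately show ?thesis
    by (subst zero_iff_supp) (auto simp: supp_def)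
qed

text \<open>An element whose support is not all of \<open>I\<close> is killed by any element
  supported exactly on the complement, while full support leaves no room for a nonzero
  annihilator.\<close>

lemma nz_zero_divisors_R:
  "nz_zero_divisors R = {x \<in> carrier R. supp Fs x \<noteq> {} \<and> supp Fs x \<noteq> I}"
proof -
  have "(\<exists>y \<in> carrier R. y \<noteq> \<zero>\<^bsub>R\<^esub> \<and> x \<otimes>\<^bsub>R\<^esub> y = \<zero>\<^bsub>R\<^esub>) \<longleftrightarrow> supp Fs x \<noteq> I"
    if x: "x \<in> carrier R" for x
  proof
    assume "\<exists>y \<in> carrier R. y \<noteq> \<zero>\<^bsub>R\<^esub> \<and> x \<otimes>\<^bsub>R\<^esub> y = \<zero>\<^bsub>R\<^esub>"
    then show "supp Fs x \<noteq> I"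
      using x supp_subset by (auto simp: mult_zero_iff_supp zero_iff_supp)
  next
    assume "supp Fs x \<noteq> I"
    moreover obtain y where "y \<in> carrier R" "supp Fs y = I - supp Fs x"
      using ex_supp_eq[of "I - supp Fs x"] by auto
    ultimately show "\<exists>y \<in> carrier R. y \<noteq> \<zero>\<^bsub>R\<^esub> \<and> x \<otimes>\<^bsub>R\<^esub> y = \<zero>\<^bsub>R\<^esub>"
      using x supp_subset by (intro bexI[of _ y]) (auto simp: mult_zero_iff_supp zero_iff_supp)
  qed
  then show ?thesis
    by (auto simp: nz_zero_divisors_def zero_divisors_def zero_iff_supp)
qed

text \<open>Annihilators of \<open>x\<close> are the elements supported off
  \<open>supp Fs x\<close>. Weak adjacency therefore asks for disjoint nonempty sets, one in each
  complement, that is, for two distinct indices. Only two equal singleton complements prevent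
  this.\<close>

lemma weak_adjacent_iff:
  assumes x: "x \<in> nz_zero_divisors R" and y: "y \<in> nz_zero_divisors R"
  shows "(\<exists>r \<in> Ann R x - {\<zero>\<^bsub>R\<^esub>}. \<exists>s \<in> Ann R y - {\<zero>\<^bsub>R\<^esub>}. r \<otimes>\<^bsub>R\<^esub> s = \<zero>\<^bsub>R\<^esub>) \<longleftrightarrow>
           \<not> (\<exists>j \<in> I. supp Fs x = I - {j} \<and> supp Fs y = I - {j})" (is "?W \<longleftrightarrow> ?C")
proof -
  have carr: "x \<in> carrier R" "y \<in> carrier R"
    and proper: "supp Fs x \<noteq> I" "supp Fs y \<noteq> I"
    using x y by (auto simp: nz_zero_divisors_R)
  have nz: "r \<in> Ann R z - {\<zero>\<^bsub>R\<^esub>} \<longleftrightarrow> r \<in> carrier R \<and> supp Fs r \<inter> supp Fs z = {} \<and> supp Fs r \<noteq> {}"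
    if "z \<in> carrier R" for z r
    using that by (auto simp: Ann_def mult_zero_iff_supp zero_iff_supp)
  show ?thesis
  proof
    assume ?W
    then obtain r s where rs: "r \<in> carrier R" "supp Fs r \<inter> supp Fs x = {}" "supp Fs r \<noteq> {}"
      "s \<in> carrier R" "supp Fs s \<inter> supp Fs y = {}" "supp Fs s \<noteq> {}" "supp Fs r \<inter> supp Fs s = {}"
    proof -
      from \<open>?W\<close> obtain r s where rs: "r \<in> Ann R x - {\<zero>\<^bsub>R\<^esub>}" "s \<in> Ann R y - {\<zero>\<^bsub>R\<^esub>}"
        and "r \<otimes>\<^bsub>R\<^esub> s = \<zero>\<^bsub>R\<^esub>" by blast
      then show thesis
        using that[of r s] nz[OF carr(1), of r] nz[OF carr(2), of s] mult_zero_iff_supp[of r s] by blast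
    qed
    show ?C
    proof
      assume "\<exists>j \<in> I. supp Fs x = I - {j} \<and> supp Fs y = I - {j}"
      then obtain j where j: "supp Fs x = I - {j}" "supp Fs y = I - {j}" by blast
      \<comment> \<open>Everything annihilating \<open>x\<close> or \<open>y\<close> lives on the
        index \<open>j\<close>, so the nonempty supports of \<open>r\<close> and \<open>s\<close>
        must meet.\<close>
      have "supp Fs r \<subseteq> {j}" using rs(2) supp_subset[of r] unfolding j by blast
      moreover have "supp Fs s \<subseteq> {j}" using rs(5) supp_subset[of s] unfolding j by blast
      ultimately show False using rs(3,6,7) by blast
    qed
  next
    assume C: ?C
    obtain i j where ij: "i \<in> I - supp Fs x" "j \<in> I - supp Fs y" "i \<noteq> j"
    proof -
      obtain i where i: "i \<in> I - supp Fs x" using proper(1) supp_subset[of x] by blast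
      obtain j where j: "j \<in> I - supp Fs y" using proper(2) supp_subset[of y] by blast
      show thesis
      proof (cases "i = j")
        case True
        \<comment> \<open>If the two chosen indices coincide, \<open>?C\<close> supplies a second
          index \<open>l\<close> missed by one of the supports; it replaces the index chosen for
          that one.\<close>
        then have "supp Fs x \<noteq> I - {i} \<or> supp Fs y \<noteq> I - {i}" using C i by blast
        then obtain l where "l \<in> I - {i}" "l \<notin> supp Fs x \<or> l \<notin> supp Fs y"
          using i j True supp_subset[of x] supp_subset[of y] by blast
        then show thesis using that i j True by blast
      qed (use that i j in blast)
    qed
    obtain r where r: "r \<in> carrier R" "supp Fs r = {i}" using ex_supp_eq[of "{i}"] ij by auto
    obtain s where s: "s \<in> carrier R" "supp Fs s = {j}" using ex_supp_eq[of "{j}"] ij by auto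
    have "r \<in> Ann R x - {\<zero>\<^bsub>R\<^esub>}" "s \<in> Ann R y - {\<zero>\<^bsub>R\<^esub>}"
      using carr nz r s ij by auto
    moreover have "r \<otimes>\<^bsub>R\<^esub> s = \<zero>\<^bsub>R\<^esub>"
      using r s ij by (simp add: mult_zero_iff_supp)
    ultimately show ?W by blast
  qed
qed

text \<open>On vertices, the first conjunct expresses a nonzero product and the second weak
  adjacency. Distinctness is left to \<open>graph_of_rel\<close>.\<close>

definition adj :: "'a list \<Rightarrow> 'a list \<Rightarrow> bool" where
  "adj x y \<longleftrightarrow> supp Fs x \<inter> supp Fs y \<noteq> {} \<and>
     \<not> (\<exists>j \<in> I. supp Fs x = I - {j} \<and> supp Fs y = I - {j})"

lemma finite_nz_zero_divisors_R: "finite (nz_zero_divisors R)"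
  using finite_carrier_R by (simp add: nz_zero_divisors_R)

text \<open>Both edge relations depend on supports only, so degrees reduce to counting elements with
  given supports.\<close>

lemma weak_difference_graph_R:
  "weak_difference_graph R = delete_isolated (graph_of_rel (nz_zero_divisors R) adj)"
proof -
  let ?V = "nz_zero_divisors R"
  let ?W = "\<lambda>x y. \<exists>r \<in> Ann R x - {\<zero>\<^bsub>R\<^esub>}. \<exists>s \<in> Ann R y - {\<zero>\<^bsub>R\<^esub>}. r \<otimes>\<^bsub>R\<^esub> s = \<zero>\<^bsub>R\<^esub>"
  have mult: "x \<otimes>\<^bsub>R\<^esub> y = \<zero>\<^bsub>R\<^esub> \<longleftrightarrow> supp Fs x \<inter> supp Fs y = {}" if "x \<in> ?V" "y \<in> ?V" for x y
    using that by (simp add: nz_zero_divisors_R mult_zero_iff_supp)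
  have "sedges (weak_zero_divisor_graph R) - sedges (zero_divisor_graph R) =
          sedges (graph_of_rel ?V (\<lambda>x y. ?W x y \<and> x \<otimes>\<^bsub>R\<^esub> y \<noteq> \<zero>\<^bsub>R\<^esub>))"
    unfolding weak_zero_divisor_graph_def zero_divisor_graph_def
    by (rule sedges_graph_of_rel_diff) (simp add: mult Int_commute)
  also have "graph_of_rel ?V (\<lambda>x y. ?W x y \<and> x \<otimes>\<^bsub>R\<^esub> y \<noteq> \<zero>\<^bsub>R\<^esub>) = graph_of_rel ?V adj"
  proof (rule graph_of_rel_cong)
    fix x y assume "x \<in> ?V" "y \<in> ?V"
    then show "?W x y \<and> x \<otimes>\<^bsub>R\<^esub> y \<noteq> \<zero>\<^bsub>R\<^esub> \<longleftrightarrow> adj x y"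
      unfolding weak_adjacent_iff[OF \<open>x \<in> ?V\<close> \<open>y \<in> ?V\<close>] adj_def by (auto simp: mult)
  qed
  finally show ?thesis
    by (simp add: weak_difference_graph_def graph_of_rel_def)
qed

section \<open>Degrees through the number of non-neighbours\<close>

text \<open>The number of non-neighbours of a vertex with support \<open>A\<close>, the vertex itself included.\<close>

definition nonadj_count :: "nat set \<Rightarrow> nat" where
  "nonadj_count A =
     (if card (I - A) = 1 then (\<Prod>i\<in>I - A. q i) - 1 + (\<Prod>i\<in>A. q i - 1)
      else \<Prod>i\<in>I - A. q i)"

lemma nonadj_count_coatom:
  assumes "j \<in> I"
  shows "nonadj_count (I - {j}) = (q j - 1) + (\<Prod>i\<in>I - {j}. q i - 1)"
  using assms by (simp add: nonadj_count_def double_diff)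

lemma nonadj_count_not_coatom:
  assumes "A \<subseteq> I" "\<not> (\<exists>j \<in> I. A = I - {j})"
  shows "nonadj_count A = (\<Prod>i\<in>I - A. q i)"
proof -
  have "card (I - A) \<noteq> 1"
  proof
    assume "card (I - A) = 1"
    then obtain j where "I - A = {j}" by (rule card_1_singletonE)
    then have "j \<in> I" "A = I - {j}" using assms(1) by blast+
    then show False using assms(2) by blast
  qed
  then show ?thesis by (simp add: nonadj_count_def)
qed

text \<open>The vertices split into the neighbours of \<open>x\<close> and the set \<open>?N\<close>
  of the rest, \<open>x\<close> included. The additive form avoids truncated subtraction.\<close>

lemma sdegree_R:
  assumes x: "x \<in> nz_zero_divisors R"
  shows "sdegree (weak_difference_graph R) x + nonadj_count (supp Fs x) = card (nz_zero_divisors R)"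
proof -
  let ?V = "nz_zero_divisors R" and ?A = "supp Fs x"
  let ?N = "{y \<in> ?V. y = x \<or> \<not> adj x y}"
  let ?K = "\<lambda>B. {y \<in> carrier R. supp Fs y \<subseteq> B} - {\<zero>\<^bsub>R\<^esub>}"
  have xc: "x \<in> carrier R" "?A \<noteq> {}" "?A \<subseteq> I" "?A \<noteq> I"
    using x supp_subset by (auto simp: nz_zero_divisors_R)
  have K: "?K B = {y \<in> carrier R. supp Fs y \<subseteq> B \<and> supp Fs y \<noteq> {}}" for B
    using zero_iff_supp by auto
  have cardK: "card (?K B) + 1 = (\<Prod>i\<in>B. q i)" "finite (?K B)" if "B \<subseteq> I" for B
  proof -
    have "\<zero>\<^bsub>R\<^esub> \<in> {y \<in> carrier R. supp Fs y \<subseteq> B}"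
      using ring.ring_simprules(2)[OF ring_R] zero_iff_supp[of "\<zero>\<^bsub>R\<^esub>"] by simp
    moreover have fin: "finite {y \<in> carrier R. supp Fs y \<subseteq> B}" using finite_carrier_R by simp
    ultimately have "card {y \<in> carrier R. supp Fs y \<subseteq> B} = Suc (card (?K B))"
      by (intro card.remove)
    then show "card (?K B) + 1 = (\<Prod>i\<in>B. q i)" "finite (?K B)"
      using card_supp_subset[OF that] fin by simp_all
  qed
  have "card ?N = nonadj_count ?A"
  proof (cases "\<exists>j \<in> I. ?A = I - {j}")
    case True
    then obtain j where j: "j \<in> I" "?A = I - {j}" by blast
    have adj: "adj x y \<longleftrightarrow> \<not> supp Fs y \<subseteq> {j} \<and> supp Fs y \<noteq> I - {j}" for y
    proof -
      have "(\<exists>i \<in> I. I - {j} = I - {i} \<and> supp Fs y = I - {i}) \<longleftrightarrow> supp Fs y = I - {j}"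
        using j(1) by blast
      moreover have "(I - {j}) \<inter> supp Fs y = {} \<longleftrightarrow> supp Fs y \<subseteq> {j}"
        using supp_subset[of y] by blast
      ultimately show ?thesis
        unfolding adj_def j(2) by blast
    qed
    have proper: "I - {j} \<noteq> {}" "I - {j} \<noteq> I" "\<not> I \<subseteq> {j}" "\<not> I - {j} \<subseteq> {j}"
      using xc j by auto
    \<comment> \<open>The set \<open>?E\<close> is the whole support class of \<open>x\<close>,
      hence contains \<open>x\<close>; the other non-neighbours are the \<open>q j - 1\<close>
      nonzero elements living on \<open>j\<close> alone.\<close>
    have "?N = ?K {j} \<union> {y \<in> carrier R. supp Fs y = I - {j}}" (is "_ = _ \<union> ?E")
    proof (rule Set.set_eqI)
      fix y
      show "y \<in> ?N \<longleftrightarrow> y \<in> ?K {j} \<union> ?E"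
        unfolding K nz_zero_divisors_R adj using xc(1) j(2) proper
        by (cases "y = x"; cases "supp Fs y = I - {j}"; cases "supp Fs y = I") (simp_all, blast?)
    qed
    moreover have "?K {j} \<inter> ?E = {}"
      unfolding K using proper by auto
    moreover have "finite ?E" using finite_carrier_R by simp
    ultimately have "card ?N = card (?K {j}) + card ?E"
      using cardK(2)[of "{j}"] j by (simp add: card_Un_disjoint)
    then show ?thesis
      using cardK(1)[of "{j}"] card_supp_eq[of "I - {j}"] j
      by (simp add: nonadj_count_coatom)
  next
    case False
    have "adj x y \<longleftrightarrow> \<not> supp Fs y \<subseteq> I - ?A" for y
      unfolding adj_def using False supp_subset[of y] by blast
    moreover have "supp Fs y \<noteq> I" if "supp Fs y \<subseteq> I - ?A" for y
      using that xc by blast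
    \<comment> \<open>The vertex \<open>x\<close> makes up for the zero left out of
      \<open>?K\<close>, so the count is exactly the product.\<close>
    ultimately have "?N = insert x (?K (I - ?A))"
      unfolding K using x by (auto simp: nz_zero_divisors_R)
    moreover have "x \<notin> ?K (I - ?A)" using xc by auto
    ultimately show ?thesis
      using cardK[of "I - ?A"] False xc(3) by (simp add: nonadj_count_not_coatom)
  qed
  moreover have "sdegree (weak_difference_graph R) x = card {y \<in> ?V. y \<noteq> x \<and> adj x y}"
    unfolding weak_difference_graph_R sdegree_delete_isolated
    using x by (intro sdegree_graph_of_rel) (auto simp: adj_def)
  moreover have "card {y \<in> ?V. y \<noteq> x \<and> adj x y} + card ?N = card ?V"
  proof -
    have "?V = {y \<in> ?V. y \<noteq> x \<and> adj x y} \<union> ?N" by blast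
    moreover have "{y \<in> ?V. y \<noteq> x \<and> adj x y} \<inter> ?N = {}" by blast
    ultimately show ?thesis
      using finite_nz_zero_divisors_R by (metis (no_types, lifting) card_Un_disjoint finite_Un)
  qed
  ultimately show ?thesis by simp
qed

text \<open>The carrier consists of the vertices, the elements of full support and zero; the last
  two kinds are separate because \<open>I\<close> is nonempty.\<close>

lemma card_nz_zero_divisors_R:
  assumes "length Fs > 0"
  shows "card (nz_zero_divisors R) + (\<Prod>i\<in>I. q i - 1) + 1 = (\<Prod>i\<in>I. q i)"
proof -
  let ?V = "nz_zero_divisors R" and ?E = "\<lambda>B. {x \<in> carrier R. supp Fs x = B}"
  have "{x \<in> carrier R. supp Fs x \<subseteq> I} = (?V \<union> ?E I) \<union> ?E {}"
    unfolding nz_zero_divisors_R using supp_subset by auto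
  moreover have "?V \<inter> ?E I = {}" "(?V \<union> ?E I) \<inter> ?E {} = {}"
    unfolding nz_zero_divisors_R using assms by auto
  moreover have "finite (?E B)" for B using finite_carrier_R by simp
  ultimately have "card {x \<in> carrier R. supp Fs x \<subseteq> I} = card ?V + card (?E I) + card (?E {})"
    using finite_nz_zero_divisors_R by (simp add: card_Un_disjoint)
  then show ?thesis
    using card_supp_subset[of I] card_supp_eq[of I] card_supp_eq[of "{}"] by simp
qed

text \<open>Supports missing one index fall strictly below the bound by
  \<open>coatom_count_less\<close>; for the others the count is a product over the complement, where
  \<open>prod_compl_le_prod_remove\<close> applies.\<close>

lemma nonadj_count_le:
  assumes len: "3 \<le> length Fs" and k: "k \<in> I" and min: "\<And>i. i \<in> I \<Longrightarrow> q k \<le> q i"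
    and A: "A \<subseteq> I" "A \<noteq> {}"
  shows "nonadj_count A \<le> (\<Prod>i\<in>I - {k}. q i)"
    and "nonadj_count A = (\<Prod>i\<in>I - {k}. q i) \<longleftrightarrow> (\<exists>j \<in> I. A = {j} \<and> q j = q k)"
proof -
  have q2: "2 \<le> q i" if "i \<in> I" for i using order_ge_2 that by simp
  have "nonadj_count A \<le> (\<Prod>i\<in>I - {k}. q i) \<and>
     (nonadj_count A = (\<Prod>i\<in>I - {k}. q i) \<longleftrightarrow> (\<exists>j \<in> I. A = {j} \<and> q j = q k))"
  proof (cases "\<exists>j \<in> I. A = I - {j}")
    case True
    then obtain j where j: "j \<in> I" "A = I - {j}" by blast
    then have "nonadj_count A < (\<Prod>i\<in>I - {k}. q i)"
      using coatom_count_less[OF _ _ j(1) k, of q] len q2 min j by (simp add: nonadj_count_coatom)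
    \<comment> \<open>With at least three indices \<open>A\<close> has at least two elements, so
      both sides of the equivalence are false.\<close>
    moreover have "A \<noteq> {i}" for i
    proof
      assume "A = {i}"
      moreover have "card A = length Fs - 1" using j by simp
      ultimately show False using len by simp
    qed
    ultimately show ?thesis by auto
  next
    case False
    then show ?thesis
      using prod_compl_le_prod_remove[OF _ A k, of q] q2 min A by (simp add: nonadj_count_not_coatom)
  qed
  then show "nonadj_count A \<le> (\<Prod>i\<in>I - {k}. q i)"
    and "nonadj_count A = (\<Prod>i\<in>I - {k}. q i) \<longleftrightarrow> (\<exists>j \<in> I. A = {j} \<and> q j = q k)"
    by auto
qed

lemma card_nz_zero_divisors_R_split:
  assumes k: "k \<in> I"
  shows "card (nz_zero_divisors R) + (q k - 1) * (\<Prod>i\<in>I - {k}. q i - 1) + 1 =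
           q k * (\<Prod>i\<in>I - {k}. q i)"
proof -
  have "(\<Prod>i\<in>I. q i) = q k * (\<Prod>i\<in>I - {k}. q i)"
    and "(\<Prod>i\<in>I. q i - 1) = (q k - 1) * (\<Prod>i\<in>I - {k}. q i - 1)"
    using k by (simp_all add: prod.remove)
  moreover have "length Fs > 0" using k by auto
  ultimately show ?thesis
    using card_nz_zero_divisors_R by simp
qed

section \<open>The minimum degree and the vertices attaining it\<close>

context
  fixes k
  assumes len: "3 \<le> length Fs" and k: "k \<in> I" and min: "\<And>i. i \<in> I \<Longrightarrow> q k \<le> q i"
begin

text \<open>This keeps the difference in the degree formula from being truncated and shows that it
  is positive, so that no vertex is isolated.\<close>

lemma prod_less_card_nz_zero_divisors_R: "(\<Prod>i\<in>I - {k}. q i) < card (nz_zero_divisors R)"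
proof -
  define a N N' where "a = q k - 1" and "N = (\<Prod>i\<in>I - {k}. q i)"
    and "N' = (\<Prod>i\<in>I - {k}. q i - 1)"
  have a: "q k = Suc a" "1 \<le> a" using order_ge_2[of k] k by (auto simp: a_def)
  have "q k - 1 + N' < N"
    unfolding N_def N'_def
    using coatom_count_less[of I k k q] len k min order_ge_2 by simp
  \<comment> \<open>Since \<open>a\<close> is at least 1, \<open>a + N' < N\<close> yields
    \<open>N' + 2 \<le> N\<close>. The number of vertices is \<open>N + a * (N - N') - 1\<close>,
    hence at least \<open>N + 2 * a - 1\<close>, which exceeds \<open>N\<close>.\<close>
  then have "a * (N' + 2) \<le> a * N" using a by (intro mult_le_mono) auto
  moreover have "card (nz_zero_divisors R) + a * N' + 1 = N + a * N"
    using card_nz_zero_divisors_R_split[OF k] a by (simp add: N_def N'_def)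
  ultimately show ?thesis
    using a by (simp add: N_def[symmetric] algebra_simps)
qed

lemma sdegree_R_ge:
  assumes x: "x \<in> nz_zero_divisors R"
  shows "card (nz_zero_divisors R) - (\<Prod>i\<in>I - {k}. q i) \<le> sdegree (weak_difference_graph R) x"
    and "sdegree (weak_difference_graph R) x = card (nz_zero_divisors R) - (\<Prod>i\<in>I - {k}. q i) \<longleftrightarrow>
           (\<exists>j \<in> I. supp Fs x = {j} \<and> q j = q k)"
proof -
  have "supp Fs x \<noteq> {}" using x by (simp add: nz_zero_divisors_R)
  note le = nonadj_count_le[OF len k min supp_subset this]
  show "card (nz_zero_divisors R) - (\<Prod>i\<in>I - {k}. q i) \<le> sdegree (weak_difference_graph R) x"
    using sdegree_R[OF x] le(1) by linarith
  \<comment> \<open>As the subtraction is exact, attaining the lower degree bound means attaining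
    the upper bound on non-neighbours.\<close>
  have "sdegree (weak_difference_graph R) x = card (nz_zero_divisors R) - (\<Prod>i\<in>I - {k}. q i) \<longleftrightarrow>
          nonadj_count (supp Fs x) = (\<Prod>i\<in>I - {k}. q i)"
    using sdegree_R[OF x] le(1) prod_less_card_nz_zero_divisors_R by linarith
  then show "sdegree (weak_difference_graph R) x = card (nz_zero_divisors R) - (\<Prod>i\<in>I - {k}. q i) \<longleftrightarrow>
               (\<exists>j \<in> I. supp Fs x = {j} \<and> q j = q k)"
    using le(2) by simp
qed

lemma sverts_weak_difference_graph_R: "sverts (weak_difference_graph R) = nz_zero_divisors R"
proof -
  have "0 < sdegree (graph_of_rel (nz_zero_divisors R) adj) x" if "x \<in> nz_zero_divisors R" for x
    using sdegree_R_ge(1)[OF that] prod_less_card_nz_zero_divisors_R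
    by (simp add: weak_difference_graph_R)
  then show ?thesis
    by (auto simp: weak_difference_graph_R sverts_delete_isolated finite_sedges_graph_of_rel
        finite_nz_zero_divisors_R)
qed

lemma min_degree_weak_difference_graph_R:
  "min_degree (weak_difference_graph R) = card (nz_zero_divisors R) - (\<Prod>i\<in>I - {k}. q i)"
proof -
  obtain x where x: "x \<in> carrier R" "supp Fs x = {k}" using ex_supp_eq[of "{k}"] k by auto
  \<comment> \<open>An element supported on \<open>k\<close> alone is a vertex only if other indices
    exist.\<close>
  have "{k} \<noteq> I"
  proof
    assume "{k} = I"
    then have "card I = card {k}" by simp
    then show False using len by simp
  qed
  then have V: "x \<in> nz_zero_divisors R" using x by (simp add: nz_zero_divisors_R)
  have "sdegree (weak_difference_graph R) x = card (nz_zero_divisors R) - (\<Prod>i\<in>I - {k}. q i)"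
    using sdegree_R_ge(2)[OF V] x(2) k by simp
  then show ?thesis
    using min_degree_eqI[of "weak_difference_graph R" x] V sdegree_R_ge(1)
    by (simp add: sverts_weak_difference_graph_R finite_nz_zero_divisors_R)
qed

lemma min_degree_verts_weak_difference_graph_R:
  "{x \<in> sverts (weak_difference_graph R).
      sdegree (weak_difference_graph R) x = min_degree (weak_difference_graph R)} =
     (\<Union>j \<in> {j \<in> I. q j = q k}. support_class Fs {j})"
  by (auto simp: sverts_weak_difference_graph_R min_degree_weak_difference_graph_R sdegree_R_ge(2)
      support_class_def)

end

end

theorem theorem7p4:
  fixes Fs :: "('a, 'm) ring_scheme list" and t kstar :: nat and q :: "nat \<Rightarrow> nat"
  assumes "length Fs = t" and "t \<ge> 3"
    and "\<And>i. i < t \<Longrightarrow> field (Fs ! i)"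
    and "\<And>i. i < t \<Longrightarrow> finite (carrier (Fs ! i))"
    and "\<And>i. i < t \<Longrightarrow> order (Fs ! i) = q i"
    and "is_arg_min q (\<lambda>i. i < t) kstar"
  defines "R \<equiv> RDirProd_list Fs"
  defines "D \<equiv> weak_difference_graph R"
  shows "{x \<in> sverts D. sdegree D x = min_degree D} =
           (\<Union>k \<in> {k. k < t \<and> q k = Min (q ` {..<t})}. support_class Fs {k})
       \<and> int (min_degree D) =
           int (card (nz_zero_divisors R)) - (\<Prod>i \<in> {..<t} - {kstar}. int (q i))
       \<and> int (min_degree D) =
           (int (q kstar) - 1) *
             ((\<Prod>i \<in> {..<t} - {kstar}. int (q i)) - (\<Prod>i \<in> {..<t} - {kstar}. (int (q i) - 1))) - 1"
proof -
  interpret FF: finite_field_list Fs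
    using assms(1,3,4) by (intro finite_field_list.intro) auto
  have k: "kstar \<in> {..<length Fs}"
    using assms(1,6) by (simp add: is_arg_min_def)
  have qmin: "q kstar \<le> q i" if "i < t" for i
    using assms(6) that by (simp add: is_arg_min_linorder)
  have ord: "order (Fs ! i) = q i" if "i < t" for i
    using assms(5) that .
  have len: "3 \<le> length Fs" using assms(1,2) by simp
  have min: "order (Fs ! kstar) \<le> order (Fs ! i)" if "i \<in> {..<length Fs}" for i
    using that k qmin ord assms(1) by simp
  have Min: "Min (q ` {..<t}) = q kstar"
    using k qmin assms(1) by (intro Min_eqI) auto
  have prods: "(\<Prod>i\<in>{..<length Fs} - {kstar}. order (Fs ! i)) = (\<Prod>i\<in>{..<t} - {kstar}. q i)"
    "(\<Prod>i\<in>{..<length Fs} - {kstar}. order (Fs ! i) - 1) = (\<Prod>i\<in>{..<t} - {kstar}. q i - 1)"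
    using ord assms(1) by (auto intro!: prod.cong)
  \<comment> \<open>The results of the locale, phrased with \<open>order (Fs ! i)\<close>, are
    rewritten in terms of \<open>q\<close>.\<close>
  note mind = FF.min_degree_weak_difference_graph_R[OF len k min, unfolded prods, folded R_def D_def]
  note less = FF.prod_less_card_nz_zero_divisors_R[OF len k min, unfolded prods, folded R_def]
  have 1: "{x \<in> sverts D. sdegree D x = min_degree D} =
           (\<Union>k \<in> {k. k < t \<and> q k = Min (q ` {..<t})}. support_class Fs {k})"
  proof -
    have "{j \<in> {..<length Fs}. order (Fs ! j) = order (Fs ! kstar)} = {k. k < t \<and> q k = q kstar}"
      using ord k assms(1) by auto
    then show ?thesis
      using FF.min_degree_verts_weak_difference_graph_R[OF len k min] by (simp add: Min R_def D_def)
  qed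
  \<comment> \<open>By \<open>less\<close> the natural-number difference in \<open>mind\<close> is
    exact and passes to the integers.\<close>
  have 2: "int (min_degree D) =
           int (card (nz_zero_divisors R)) - (\<Prod>i \<in> {..<t} - {kstar}. int (q i))"
    using mind less by (simp add: of_nat_diff)
  \<comment> \<open>Orders are at least 2, so \<open>q i - 1\<close> is not truncated
    either.\<close>
  have pred: "int (q i - 1) = int (q i) - 1" if "i < t" for i
    using FF.order_ge_2[of i] ord[OF that] that assms(1) by simp
  then have "(\<Prod>i \<in> {..<t} - {kstar}. int (q i) - 1) = int (\<Prod>i\<in>{..<t} - {kstar}. q i - 1)"
    unfolding of_nat_prod by (intro prod.cong) auto
  moreover have "int (card (nz_zero_divisors R) + (q kstar - 1) * (\<Prod>i\<in>{..<t} - {kstar}. q i - 1) + 1) =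
      int (q kstar * (\<Prod>i\<in>{..<t} - {kstar}. q i))"
    using FF.card_nz_zero_divisors_R_split[OF k, unfolded prods, folded R_def] ord[of kstar] k assms(1)
    by simp
  ultimately have "int (card (nz_zero_divisors R)) =
      int (q kstar) * (\<Prod>i \<in> {..<t} - {kstar}. int (q i)) -
      (int (q kstar) - 1) * (\<Prod>i \<in> {..<t} - {kstar}. int (q i) - 1) - 1"
    using pred[of kstar] k assms(1) by (simp only: of_nat_add of_nat_mult of_nat_prod) simp
  \<comment> \<open>Subtracting the product over the indices other than \<open>kstar\<close> lowers
    its coefficient from \<open>q kstar\<close> to \<open>q kstar - 1\<close>, the coefficient of
    the other product.\<close>
  then have 3: "int (min_degree D) =
             (int (q kstar) - 1) *
               ((\<Prod>i \<in> {..<t} - {kstar}. int (q i)) - (\<Prod>i \<in> {..<t} - {kstar}. (int (q i) - 1))) - 1"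
    unfolding 2 by (simp add: algebra_simps)
  show ?thesis
    using 1 2 3 by blast
qed

end
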